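(* Realizability of $\forall^*\exists^*$ HyperLTL is undecidable: there is no algorithm that, given $\mathrm{AP} = I \mathbin{\dot\cup} O$ and a HyperLTL formula $\forall \pi_1 \cdots \forall \pi_n \exists \pi'_1 \cdots \exists \pi'_m.\ \psi$ over $\mathrm{AP}$ ($\psi$ quantifier-free), decides whether it is realizable.
   Context: HyperLTL formulas over $\mathrm{AP}$ are built as $\varphi ::= \exists \pi.\varphi \mid \forall \pi.\varphi \mid \psi$ and $\psi ::= a_\pi \mid \neg\psi \mid \psi\lor\psi \mid \mathsf{X}\psi \mid \psi\,\mathsf{U}\,\psi$ with $a \in \mathrm{AP}$ and trace variables $\pi$. A set of traces $T \subseteq (2^{\mathrm{AP}})^\omega$ satisfies a formula under the standard semantics where quantifiers range over traces in $T$. A strategy is a function $f\colon (2^I)^+ \to 2^O$; the set of traces generated by $f$ consists of all traces $w$ with $w_i \cap O = f((w_0\cap I)\cdots(w_i\cap I))$ for all $i\ge 0$. A formula is realizable if there is a strategy whose set of generated traces satisfies it. *)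

theory Defs
  imports Main "HOL-Library.Nat_Bijection" "HOL-Library.FuncSet"
begin

section \<open>HyperLTL\<close>

datatype (atoms: 'a, tvars: 'v) ltl =
    Atom 'a 'v
  | Neg "('a, 'v) ltl"
  | Or "('a, 'v) ltl" "('a, 'v) ltl"
  | Next "('a, 'v) ltl"
  | Until "('a, 'v) ltl" "('a, 'v) ltl"

datatype ('a, 'v) hyperltl =
    Exists 'v "('a, 'v) hyperltl"
  | Forall 'v "('a, 'v) hyperltl"
  | QF "('a, 'v) ltl"

type_synonym 'a trace = "nat \<Rightarrow> 'a set"

text \<open>Trace assignments are partial. On closed formulas, the value of \<^term>\<open>the None\<close> is
  never consulted.\<close>

primrec ltl_sat :: "('v \<rightharpoonup> 'a trace) \<Rightarrow> nat \<Rightarrow> ('a, 'v) ltl \<Rightarrow> bool" where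
  "ltl_sat \<sigma> i (Atom a p) \<longleftrightarrow> a \<in> the (\<sigma> p) i"
| "ltl_sat \<sigma> i (Neg \<psi>) \<longleftrightarrow> \<not> ltl_sat \<sigma> i \<psi>"
| "ltl_sat \<sigma> i (Or \<psi>1 \<psi>2) \<longleftrightarrow> ltl_sat \<sigma> i \<psi>1 \<or> ltl_sat \<sigma> i \<psi>2"
| "ltl_sat \<sigma> i (Next \<psi>) \<longleftrightarrow> ltl_sat \<sigma> (Suc i) \<psi>"
| "ltl_sat \<sigma> i (Until \<psi>1 \<psi>2) \<longleftrightarrow>
     (\<exists>j\<ge>i. ltl_sat \<sigma> j \<psi>2 \<and> (\<forall>k. i \<le> k \<and> k < j \<longrightarrow> ltl_sat \<sigma> k \<psi>1))"

primrec hyper_sat :: "'a trace set \<Rightarrow> ('v \<rightharpoonup> 'a trace) \<Rightarrow> ('a, 'v) hyperltl \<Rightarrow> bool" where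
  "hyper_sat T \<sigma> (Exists p \<phi>) \<longleftrightarrow> (\<exists>t\<in>T. hyper_sat T (\<sigma>(p \<mapsto> t)) \<phi>)"
| "hyper_sat T \<sigma> (Forall p \<phi>) \<longleftrightarrow> (\<forall>t\<in>T. hyper_sat T (\<sigma>(p \<mapsto> t)) \<phi>)"
| "hyper_sat T \<sigma> (QF \<psi>) \<longleftrightarrow> ltl_sat \<sigma> 0 \<psi>"

definition satisfies :: "'a trace set \<Rightarrow> ('a, 'v) hyperltl \<Rightarrow> bool" where
  "satisfies T \<phi> \<longleftrightarrow> hyper_sat T Map.empty \<phi>"


section \<open>Realizability\<close>

definition strategies :: "'a set \<Rightarrow> 'a set \<Rightarrow> ('a set list \<Rightarrow> 'a set) set" where
  "strategies Inp Out = (lists (Pow Inp) - {[]}) \<rightarrow> Pow Out"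

definition generated_traces ::
    "'a set \<Rightarrow> 'a set \<Rightarrow> ('a set list \<Rightarrow> 'a set) \<Rightarrow> 'a trace set" where
  "generated_traces Inp Out f =
     {w. (\<forall>i. w i \<subseteq> Inp \<union> Out) \<and> (\<forall>i. w i \<inter> Out = f (map (\<lambda>j. w j \<inter> Inp) [0..<Suc i]))}"

definition realizable :: "'a set \<Rightarrow> 'a set \<Rightarrow> ('a, 'v) hyperltl \<Rightarrow> bool" where
  "realizable Inp Out \<phi> \<longleftrightarrow> (\<exists>f\<in>strategies Inp Out. satisfies (generated_traces Inp Out f) \<phi>)"


section \<open>Algorithms\<close>

text \<open>Algorithms are partial (\<open>\<mu>\<close>-)recursive functions; \<open>rec_eval f xs y\<close> says that \<open>f\<close> is
  defined on the arguments \<open>xs\<close> with value \<open>y\<close>. Terms carry no arity: \<open>Zero\<close> accepts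
  any argument list, \<open>Proj i\<close> any list longer than \<open>i\<close>, and a wrong number of arguments
  otherwise means that there is no value. \<open>PrimRec\<close> recurses on, and \<open>Minimize\<close>
  searches for, the first argument.\<close>

datatype recfun =
    Zero
  | Succ
  | Proj nat
  | Comp recfun "recfun list"
  | PrimRec recfun recfun
  | Minimize recfun

inductive rec_eval :: "recfun \<Rightarrow> nat list \<Rightarrow> nat \<Rightarrow> bool" where
  Zero: "rec_eval Zero xs 0"
| Succ: "rec_eval Succ [x] (Suc x)"
| Proj: "i < length xs \<Longrightarrow> rec_eval (Proj i) xs (xs ! i)"
| Comp: "list_all2 (\<lambda>g y. rec_eval g xs y) gs ys \<Longrightarrow> rec_eval f ys z
    \<Longrightarrow> rec_eval (Comp f gs) xs z"
| PrimRec_0: "rec_eval f xs y \<Longrightarrow> rec_eval (PrimRec f g) (0 # xs) y"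
| PrimRec_Suc: "rec_eval (PrimRec f g) (n # xs) r \<Longrightarrow> rec_eval g (n # r # xs) y
    \<Longrightarrow> rec_eval (PrimRec f g) (Suc n # xs) y"
| Minimize: "rec_eval f (n # xs) 0 \<Longrightarrow> (\<forall>m<n. \<exists>k. rec_eval f (m # xs) (Suc k))
    \<Longrightarrow> rec_eval (Minimize f) xs n"

inductive_cases rec_evalE:
  "rec_eval Zero xs y"
  "rec_eval Succ xs y"
  "rec_eval (Proj i) xs y"
  "rec_eval (Comp f gs) xs y"
  "rec_eval (PrimRec f g) (0 # xs) y"
  "rec_eval (PrimRec f g) (Suc n # xs) y"
  "rec_eval (Minimize f) xs y"

lemma rec_eval_deterministic:
  "rec_eval f xs y \<Longrightarrow> rec_eval f xs z \<Longrightarrow> y = z"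
proof (induction arbitrary: z rule: rec_eval.induct)
  case (Comp xs gs ys f y)
  from Comp.prems obtain ys' where
    *: "list_all2 (\<lambda>g y. rec_eval g xs y) gs ys'" "rec_eval f ys' z"
    by (rule rec_evalE)
  have "ys = ys'"
    using Comp.IH(1) *(1) by (auto simp: list_all2_conv_all_nth intro!: nth_equalityI)
  then show ?case using Comp.IH(2) *(2) by auto
next
  case (PrimRec_Suc f g n xs r y)
  from PrimRec_Suc.prems obtain r' where
    *: "rec_eval (PrimRec f g) (n # xs) r'" "rec_eval g (n # r' # xs) z"
    by (rule rec_evalE)
  have "r = r'" using PrimRec_Suc.IH(1) *(1) by blast
  then show ?case using PrimRec_Suc.IH(2) *(2) by blast
next
  case (Minimize f n xs)
  from Minimize.prems obtain *: "rec_eval f (z # xs) 0"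
      "\<forall>m<z. \<exists>k. rec_eval f (m # xs) (Suc k)"
    by (rule rec_evalE)
  show ?case
  proof (rule linorder_cases[of n z])
    assume "n < z"
    then show ?thesis using Minimize.IH(1) *(2) by (metis nat.distinct(1))
  next
    assume "z < n"
    then show ?thesis using Minimize.IH(2) *(1) by (metis nat.distinct(1))
  qed
next
  case (PrimRec_0 f xs y g)
  from PrimRec_0.prems show ?case
    by (rule rec_evalE) (use PrimRec_0.IH in blast)
qed (erule rec_evalE; simp)+

text \<open>Decidability of \<open>P\<close> on the instances \<open>A\<close>, presented to the algorithm as numbers. The
  algorithm must halt with the right answer on every instance; its behaviour on numbers that
  are not the code of an instance is unconstrained.\<close>

definition decidable :: "('i \<Rightarrow> nat) \<Rightarrow> 'i set \<Rightarrow> ('i \<Rightarrow> bool) \<Rightarrow> bool" where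
  "decidable code A P \<longleftrightarrow> (\<exists>f. \<forall>x\<in>A. rec_eval f [code x] (if P x then 1 else 0))"


section \<open>The decision problem\<close>

text \<open>Propositions and trace variables are named by natural numbers.\<close>

primrec ltl_code :: "(nat, nat) ltl \<Rightarrow> nat" where
  "ltl_code (Atom a p) = prod_encode (0, prod_encode (a, p))"
| "ltl_code (Neg \<psi>) = prod_encode (1, ltl_code \<psi>)"
| "ltl_code (Or \<psi>1 \<psi>2) = prod_encode (2, prod_encode (ltl_code \<psi>1, ltl_code \<psi>2))"
| "ltl_code (Next \<psi>) = prod_encode (3, ltl_code \<psi>)"
| "ltl_code (Until \<psi>1 \<psi>2) = prod_encode (4, prod_encode (ltl_code \<psi>1, ltl_code \<psi>2))"

primrec hyperltl_code :: "(nat, nat) hyperltl \<Rightarrow> nat" where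
  "hyperltl_code (Exists p \<phi>) = prod_encode (0, prod_encode (p, hyperltl_code \<phi>))"
| "hyperltl_code (Forall p \<phi>) = prod_encode (1, prod_encode (p, hyperltl_code \<phi>))"
| "hyperltl_code (QF \<psi>) = prod_encode (2, ltl_code \<psi>)"

type_synonym problem_instance = "nat set \<times> nat set \<times> (nat, nat) hyperltl"

definition instance_code :: "problem_instance \<Rightarrow> nat" where
  "instance_code = (\<lambda>(Inp, Out, \<phi>).
     prod_encode (set_encode Inp, prod_encode (set_encode Out, hyperltl_code \<phi>)))"

definition forall_exists_instances :: "problem_instance set" where
  "forall_exists_instances =
     {(Inp, Out, foldr Forall ps (foldr Exists qs (QF \<psi>))) | Inp Out ps qs \<psi>.
        finite Inp \<and> finite Out \<and> Inp \<inter> Out = {} \<and>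
        atoms \<psi> \<subseteq> Inp \<union> Out \<and> tvars \<psi> \<subseteq> set ps \<union> set qs}"

lemma ltl_code_inject: "ltl_code \<psi> = ltl_code \<psi>' \<longleftrightarrow> \<psi> = \<psi>'"
proof (induction \<psi> arbitrary: \<psi>')
  case (Atom a p) show ?case by (cases \<psi>') auto
next
  case (Neg \<psi>) then show ?case by (cases \<psi>') auto
next
  case (Or \<psi>1 \<psi>2) then show ?case by (cases \<psi>') auto
next
  case (Next \<psi>) then show ?case by (cases \<psi>') auto
next
  case (Until \<psi>1 \<psi>2) then show ?case by (cases \<psi>') auto
qed

lemma hyperltl_code_inject: "hyperltl_code \<phi> = hyperltl_code \<phi>' \<longleftrightarrow> \<phi> = \<phi>'"
proof (induction \<phi> arbitrary: \<phi>')
  case (Exists p \<phi>) then show ?case by (cases \<phi>') auto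
next
  case (Forall p \<phi>) then show ?case by (cases \<phi>') auto
next
  case (QF \<psi>) show ?case by (cases \<phi>') (auto simp: ltl_code_inject)
qed

lemma inj_on_instance_code: "inj_on instance_code forall_exists_instances"
  by (auto simp: inj_on_def instance_code_def forall_exists_instances_def
      hyperltl_code_inject set_encode_eq)

end

theory Submission
  imports Defs "HOL-Library.Countable"
begin

text \<open>A vector of numbers is presented by the input trace in which proposition \<open>j + 1\<close> holds exactly
  at the position given by the \<open>j\<close>-th entry. As all input traces occur, the output marks define
  an arbitrary set of vectors, and universal trace quantifiers suffice to demand that this set be
  closed under Horn clauses built from equalities and successors. Such clauses axiomatise the
  evaluation of any recursive function \<open>g\<close>, so the formula that also forbids marking the fact
  \<open>g(a, b) = 1\<close> is realizable iff \<open>g(a, b) \<noteq> 1\<close>. Given a decision procedure, take for \<open>g\<close> the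
  function that assembles the code of this very formula from \<open>a\<close> and \<open>b\<close>, the codes of the
  parts of it that depend on \<open>g\<close>, and asks the procedure whether it is realizable.\<close>

section \<open>Sets of vectors defined by output marks\<close>

abbreviation ltl_and :: "('a, 'v) ltl \<Rightarrow> ('a, 'v) ltl \<Rightarrow> ('a, 'v) ltl" where
  "ltl_and \<psi> \<chi> \<equiv> Neg (Or (Neg \<psi>) (Neg \<chi>))"

abbreviation ltl_true :: "(nat, nat) ltl" where
  "ltl_true \<equiv> Or (Atom 0 0) (Neg (Atom 0 0))"

abbreviation eventually_ltl :: "(nat, nat) ltl \<Rightarrow> (nat, nat) ltl" where
  "eventually_ltl \<psi> \<equiv> Until ltl_true \<psi>"

abbreviation nexts :: "nat \<Rightarrow> ('a, 'v) ltl \<Rightarrow> ('a, 'v) ltl" where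
  "nexts n \<equiv> Next ^^ n"

lemma ltl_sat_nexts [simp]: "ltl_sat \<sigma> i (nexts n \<psi>) \<longleftrightarrow> ltl_sat \<sigma> (i + n) \<psi>"
  by (induction n arbitrary: i) auto

lemma atoms_nexts [simp]: "atoms (nexts n \<psi>) = atoms \<psi>"
  by (induction n) auto

lemma tvars_nexts [simp]: "tvars (nexts n \<psi>) = tvars \<psi>"
  by (induction n) auto

section \<open>Traces that present vectors\<close>

definition exactly_once :: "nat \<Rightarrow> nat \<Rightarrow> (nat, nat) ltl" where
  "exactly_once p i =
     Until (Neg (Atom p i)) (ltl_and (Atom p i) (Next (Neg (eventually_ltl (Atom p i)))))"

lemma ltl_sat_exactly_once:
  "ltl_sat \<sigma> 0 (exactly_once p i) \<longleftrightarrow> (\<exists>t. \<forall>k. p \<in> the (\<sigma> i) k \<longleftrightarrow> k = t)"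
proof
  assume "ltl_sat \<sigma> 0 (exactly_once p i)"
  then obtain t where t: "p \<in> the (\<sigma> i) t" "\<forall>k<t. p \<notin> the (\<sigma> i) k" "\<forall>k\<ge>Suc t. p \<notin> the (\<sigma> i) k"
    by (auto simp: exactly_once_def)
  have "p \<in> the (\<sigma> i) k \<longleftrightarrow> k = t" for k
    using t by (cases k t rule: linorder_cases) auto
  then show "\<exists>t. \<forall>k. p \<in> the (\<sigma> i) k \<longleftrightarrow> k = t" by blast
qed (auto simp: exactly_once_def)

definition conj_list :: "(nat, nat) ltl list \<Rightarrow> (nat, nat) ltl" where
  "conj_list \<psi>s = foldr ltl_and \<psi>s ltl_true"

lemma ltl_sat_conj_list [simp]: "ltl_sat \<sigma> i (conj_list \<psi>s) \<longleftrightarrow> (\<forall>\<psi>\<in>set \<psi>s. ltl_sat \<sigma> i \<psi>)"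
  by (induction \<psi>s) (auto simp: conj_list_def)

lemma atoms_conj_list [simp]: "atoms (conj_list \<psi>s) = insert 0 (\<Union>\<psi>\<in>set \<psi>s. atoms \<psi>)"
  by (induction \<psi>s) (auto simp: conj_list_def)

lemma tvars_conj_list [simp]: "tvars (conj_list \<psi>s) = insert 0 (\<Union>\<psi>\<in>set \<psi>s. tvars \<psi>)"
  by (induction \<psi>s) (auto simp: conj_list_def)

definition represents :: "nat \<Rightarrow> nat trace \<Rightarrow> (nat \<Rightarrow> nat) \<Rightarrow> bool" where
  "represents K w v \<longleftrightarrow> (\<forall>j<K. \<forall>k. Suc j \<in> w k \<longleftrightarrow> k = v j)"

text \<open>Four trace variables: 0 to 2 will hold the premises and the conclusion of a clause, 3
  the parameters.\<close>

definition well_formed :: "nat \<Rightarrow> (nat, nat) ltl" where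
  "well_formed K = conj_list [exactly_once (Suc j) i. i \<leftarrow> [0..<4], j \<leftarrow> [0..<K]]"

text \<open>Padding with zeros from \<open>K\<close> on makes the vector unique for its trace, so
  that a mark on the trace can stand for membership of this one vector.\<close>

lemma ltl_sat_well_formed:
  "ltl_sat \<sigma> 0 (well_formed K) \<longleftrightarrow> (\<forall>i<4. \<exists>v. (\<forall>j\<ge>K. v j = 0) \<and> represents K (the (\<sigma> i)) v)"
    (is "_ \<longleftrightarrow> ?rhs")
proof -
  have "ltl_sat \<sigma> 0 (well_formed K) \<longleftrightarrow>
      (\<forall>i<4. \<forall>j<K. \<exists>t. \<forall>k. Suc j \<in> the (\<sigma> i) k \<longleftrightarrow> k = t)"
    by (auto simp: well_formed_def ltl_sat_exactly_once)
  also have "\<dots> \<longleftrightarrow> ?rhs"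
  proof (intro iffI allI impI)
    fix i :: nat assume *: "\<forall>i<4. \<forall>j<K. \<exists>t. \<forall>k. Suc j \<in> the (\<sigma> i) k \<longleftrightarrow> k = t" "i < 4"
    then have "\<forall>j. \<exists>t. j < K \<longrightarrow> (\<forall>k. Suc j \<in> the (\<sigma> i) k \<longleftrightarrow> k = t)" by blast
    then obtain v where "\<forall>j<K. \<forall>k. Suc j \<in> the (\<sigma> i) k \<longleftrightarrow> k = v j" by metis
    then show "\<exists>v. (\<forall>j\<ge>K. v j = 0) \<and> represents K (the (\<sigma> i)) v"
      by (intro exI[of _ "\<lambda>j. if j < K then v j else 0"]) (auto simp: represents_def)
  next
    fix i j :: nat assume "?rhs" "i < 4" "j < K"
    then obtain v where "represents K (the (\<sigma> i)) v" by blast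
    then show "\<exists>t. \<forall>k. Suc j \<in> the (\<sigma> i) k \<longleftrightarrow> k = t"
      unfolding represents_def using \<open>j < K\<close> by (intro exI[of _ "v j"]) blast
  qed
  finally show ?thesis .
qed

lemma atoms_well_formed: "atoms (well_formed K) \<subseteq> {..K}"
  by (auto simp: well_formed_def exactly_once_def)

lemma tvars_well_formed: "tvars (well_formed K) \<subseteq> {..<4}"
  by (auto simp: well_formed_def exactly_once_def)

section \<open>Conditions on vectors definable in LTL\<close>

definition interpretation_of ::
    "nat \<Rightarrow> (nat \<rightharpoonup> nat trace) \<Rightarrow> (nat \<Rightarrow> nat) set \<Rightarrow> (nat \<Rightarrow> nat \<Rightarrow> nat) \<Rightarrow> bool" where
  "interpretation_of K \<sigma> S v \<longleftrightarrow>
     (\<forall>i<4. represents K (the (\<sigma> i)) (v i) \<and> ((\<exists>k. 0 \<in> the (\<sigma> i) k) \<longleftrightarrow> v i \<in> S))"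

text \<open>One formula must serve all sufficiently large \<open>K\<close>. Formulas with different
  bounds can then be combined, and \<open>K\<close> is fixed only at the end.\<close>

definition definable :: "((nat \<Rightarrow> nat) set \<Rightarrow> (nat \<Rightarrow> nat \<Rightarrow> nat) \<Rightarrow> bool) \<Rightarrow> bool" where
  "definable P \<longleftrightarrow> (\<exists>\<psi> N. atoms \<psi> \<subseteq> {..N} \<and> tvars \<psi> \<subseteq> {..<4} \<and>
     (\<forall>K\<ge>N. \<forall>\<sigma> S v. interpretation_of K \<sigma> S v \<longrightarrow> (ltl_sat \<sigma> 0 \<psi> \<longleftrightarrow> P S v)))"

lemma definableI:
  assumes "atoms \<psi> \<subseteq> {..N}" "tvars \<psi> \<subseteq> {..<4}"
    and "\<And>K \<sigma> S v. K \<ge> N \<Longrightarrow> interpretation_of K \<sigma> S v \<Longrightarrow> ltl_sat \<sigma> 0 \<psi> \<longleftrightarrow> P S v"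
  shows "definable P"
  using assms unfolding definable_def by blast

lemma definable_mem: "i < 4 \<Longrightarrow> definable (\<lambda>S v. v i \<in> S)"
  by (rule definableI[of "eventually_ltl (Atom 0 i)" 0]) (auto simp: interpretation_of_def)

lemma definable_eq_const: "i < 4 \<Longrightarrow> definable (\<lambda>S v. v i j = c)"
  by (rule definableI[of "nexts c (Atom (Suc j) i)" "Suc j"])
    (auto simp: interpretation_of_def represents_def)

text \<open>Each proposition holds at one position only, so two entries agree iff their propositions
  meet somewhere on the two traces; for a successor they lie one step apart.\<close>

lemma definable_eq: "i < 4 \<Longrightarrow> i' < 4 \<Longrightarrow> definable (\<lambda>S v. v i j = v i' j')"
  by (rule definableI[of "eventually_ltl (ltl_and (Atom (Suc j) i) (Atom (Suc j') i'))" "Suc (max j j')"])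
    (auto simp: interpretation_of_def represents_def)

lemma definable_eq_Suc: "i < 4 \<Longrightarrow> i' < 4 \<Longrightarrow> definable (\<lambda>S v. v i j = Suc (v i' j'))"
  by (rule definableI[of "eventually_ltl (ltl_and (Next (Atom (Suc j) i)) (Atom (Suc j') i'))" "Suc (max j j')"])
    (auto simp: interpretation_of_def represents_def)

lemma definable_not:
  assumes "definable P" shows "definable (\<lambda>S v. \<not> P S v)"
proof -
  from assms obtain \<psi> N where "atoms \<psi> \<subseteq> {..N}" "tvars \<psi> \<subseteq> {..<4}"
    "\<forall>K\<ge>N. \<forall>\<sigma> S v. interpretation_of K \<sigma> S v \<longrightarrow> (ltl_sat \<sigma> 0 \<psi> \<longleftrightarrow> P S v)"
    unfolding definable_def by blast
  then show ?thesis by (intro definableI[of "Neg \<psi>" N]) auto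
qed

lemma definable_or:
  assumes "definable P" "definable Q" shows "definable (\<lambda>S v. P S v \<or> Q S v)"
proof -
  from assms(1) obtain \<psi> N where 1: "atoms \<psi> \<subseteq> {..N}" "tvars \<psi> \<subseteq> {..<4}"
    "\<forall>K\<ge>N. \<forall>\<sigma> S v. interpretation_of K \<sigma> S v \<longrightarrow> (ltl_sat \<sigma> 0 \<psi> \<longleftrightarrow> P S v)"
    unfolding definable_def by blast
  from assms(2) obtain \<chi> M where 2: "atoms \<chi> \<subseteq> {..M}" "tvars \<chi> \<subseteq> {..<4}"
    "\<forall>K\<ge>M. \<forall>\<sigma> S v. interpretation_of K \<sigma> S v \<longrightarrow> (ltl_sat \<sigma> 0 \<chi> \<longleftrightarrow> Q S v)"
    unfolding definable_def by blast
  show ?thesis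
    using 1 2 by (intro definableI[of "Or \<psi> \<chi>" "max N M"]) (fastforce simp: le_max_iff_disj)+
qed

lemma definable_and:
  assumes "definable P" "definable Q" shows "definable (\<lambda>S v. P S v \<and> Q S v)"
  using definable_not[OF definable_or[OF definable_not definable_not], OF assms] by simp

lemma definable_const: "definable (\<lambda>S v. b)"
  by (cases b) (rule definableI[of ltl_true 0] definableI[of "Neg ltl_true" 0]; simp)+

lemma definable_Bex:
  assumes "finite A" "\<And>x. x \<in> A \<Longrightarrow> definable (P x)"
  shows "definable (\<lambda>S v. \<exists>x\<in>A. P x S v)"
  using assms by (induction A) (auto intro: definable_const definable_or)

section \<open>From strategies to sets of vectors and back\<close>

definition input_at :: "nat \<Rightarrow> (nat \<Rightarrow> nat) \<Rightarrow> nat \<Rightarrow> nat set" where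
  "input_at K v k = {Suc j |j. j < K \<and> v j = k}"

text \<open>The trace that \<open>f\<close> generates when the environment plays the presentation of
  \<open>v\<close>.\<close>

definition response :: "nat \<Rightarrow> (nat set list \<Rightarrow> nat set) \<Rightarrow> (nat \<Rightarrow> nat) \<Rightarrow> nat trace" where
  "response K f v k = input_at K v k \<union> f (map (input_at K v) [0..<Suc k])"

lemma
  assumes f: "f \<in> strategies {1..K} {0}"
  shows response_generated: "response K f v \<in> generated_traces {1..K} {0} f"
    and represents_response: "represents K (response K f v) v"
proof -
  have inp: "input_at K v k \<subseteq> {1..K}" for k by (auto simp: input_at_def)
  have out: "f (map (input_at K v) [0..<Suc k]) \<subseteq> {0}" for k
  proof -
    have "set (map (input_at K v) [0..<Suc k]) \<subseteq> Pow {1..K}" using inp by (auto simp del: upt_Suc)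
    then have "map (input_at K v) [0..<Suc k] \<in> lists (Pow {1..K}) - {[]}" by (simp add: lists_eq_set)
    then show ?thesis using f unfolding strategies_def by blast
  qed
  have 1: "response K f v k \<inter> {1..K} = input_at K v k"
    and 2: "response K f v k \<inter> {0} = f (map (input_at K v) [0..<Suc k])" for k
    using inp[of k] out[of k] by (auto simp: response_def input_at_def simp del: upt_Suc)
  show "response K f v \<in> generated_traces {1..K} {0} f"
    unfolding generated_traces_def using 1 2 inp out
    by (fastforce simp: response_def simp del: upt_Suc)
  show "represents K (response K f v) v"
    unfolding represents_def
  proof (intro allI impI)
    fix j k assume "j < K"
    then have "Suc j \<in> response K f v k \<longleftrightarrow> Suc j \<in> response K f v k \<inter> {1..K}" by auto
    also have "\<dots> \<longleftrightarrow> k = v j" unfolding 1 using \<open>j < K\<close> by (auto simp: input_at_def)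
    finally show "Suc j \<in> response K f v k \<longleftrightarrow> k = v j" .
  qed
qed

text \<open>The parameters enter by \<open>Next\<close> chains only, so that the code of the formula is easily computed
  from them. They are read off a separate trace variable: constraints on the others are
  enforced in spite of the guard, as some trace satisfies it.\<close>

definition guarded :: "nat \<Rightarrow> nat \<Rightarrow> (nat, nat) ltl \<Rightarrow> (nat, nat) ltl" where
  "guarded a b \<psi> = Or (Neg (nexts a (Atom 3 3))) (Or (Neg (nexts b (Atom 4 3))) \<psi>)"

definition parametric_formula :: "nat \<Rightarrow> nat \<Rightarrow> (nat, nat) ltl \<Rightarrow> (nat, nat) hyperltl" where
  "parametric_formula a b \<psi> = Forall 0 (Forall 1 (Forall 2 (Forall 3 (QF (guarded a b \<psi>)))))"

lemma all_less_four: "(\<forall>i<4. P i) \<longleftrightarrow> P 0 \<and> P 1 \<and> P 2 \<and> P (3::nat)"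
  by (auto simp: numeral_eq_Suc less_Suc_eq)

definition assignment :: "(nat \<Rightarrow> nat trace) \<Rightarrow> (nat \<rightharpoonup> nat trace)" where
  "assignment w = [0 \<mapsto> w 0, 1 \<mapsto> w 1, 2 \<mapsto> w 2, 3 \<mapsto> w 3]"

lemma the_assignment [simp]: "i < 4 \<Longrightarrow> the (assignment w i) = w i"
  by (auto simp: assignment_def numeral_eq_Suc less_Suc_eq)

lemma satisfies_parametric_formula:
  "satisfies T (parametric_formula a b \<psi>) \<longleftrightarrow>
     (\<forall>w. (\<forall>i<4. w i \<in> T) \<longrightarrow> ltl_sat (assignment w) 0 (guarded a b \<psi>))"
  (is "?l \<longleftrightarrow> ?r")
proof
  assume ?l then show ?r
    by (auto simp: satisfies_def parametric_formula_def all_less_four assignment_def)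
next
  assume r: ?r
  show ?l unfolding satisfies_def parametric_formula_def hyper_sat.simps
  proof (intro ballI)
    fix w0 w1 w2 w3 assume "w0 \<in> T" "w1 \<in> T" "w2 \<in> T" "w3 \<in> T"
    then show "ltl_sat [0 \<mapsto> w0, 1 \<mapsto> w1, 2 \<mapsto> w2, 3 \<mapsto> w3] 0 (guarded a b \<psi>)"
      using r[rule_format, of "(\<lambda>_. w3)(0 := w0, 1 := w1, 2 := w2)"] by (simp add: all_less_four assignment_def)
  qed
qed

text \<open>\<open>P\<close> describes violations. A strategy yields the set of vectors whose
  response is ever marked; conversely, a set is realized by marking a trace once its vector has been
  read in full. \<open>K\<close> and \<open>\<psi>\<close> depend on \<open>P\<close> alone and are
  fixed before \<open>a\<close> and \<open>b\<close>, which the final self-reference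
  requires.\<close>

lemma realizable_parametric_formula:
  assumes "definable P"
  obtains K \<psi> where "K \<ge> 4" "atoms \<psi> \<subseteq> {..K}" "tvars \<psi> \<subseteq> {..<4}"
    "\<And>a b. realizable {1..K} {0} (parametric_formula a b \<psi>) \<longleftrightarrow>
       (\<exists>S. \<forall>v. v 3 2 = a \<and> v 3 3 = b \<longrightarrow> \<not> P S v)"
proof -
  from assms obtain \<chi> N where \<chi>: "atoms \<chi> \<subseteq> {..N}" "tvars \<chi> \<subseteq> {..<4}"
    "\<And>K \<sigma> S v. K \<ge> N \<Longrightarrow> interpretation_of K \<sigma> S v \<Longrightarrow> ltl_sat \<sigma> 0 \<chi> \<longleftrightarrow> P S v"
    unfolding definable_def by blast
  \<comment> \<open>The guard reads propositions 3 and 4, so these must be among the inputs.\<close>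
  define K where "K = max N 4"
  define \<psi> where "\<psi> = Or (Neg (well_formed K)) (Neg \<chi>)"
  have K: "K \<ge> N" "K \<ge> 4" by (auto simp: K_def)
  have guard: "ltl_sat (assignment w) 0 (guarded a b \<psi>) \<longleftrightarrow>
      (v 3 2 = a \<and> v 3 3 = b \<longrightarrow> ltl_sat (assignment w) 0 \<psi>)"
    if "represents K (w 3) (v 3)" for w :: "nat \<Rightarrow> nat trace" and v :: "nat \<Rightarrow> nat \<Rightarrow> nat" and a b
  proof -
    have "Suc 2 \<in> w 3 a \<longleftrightarrow> a = v 3 2" "Suc 3 \<in> w 3 b \<longleftrightarrow> b = v 3 3"
      using that K by (simp_all add: represents_def del: Suc_numeral)
    then show ?thesis by (auto simp: guarded_def)
  qed
  have "realizable {1..K} {0} (parametric_formula a b \<psi>) \<longleftrightarrow>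
       (\<exists>S. \<forall>v. v 3 2 = a \<and> v 3 3 = b \<longrightarrow> \<not> P S v)" for a b
  proof
    assume "realizable {1..K} {0} (parametric_formula a b \<psi>)"
    then obtain f where f: "f \<in> strategies {1..K} {0}"
      and sat: "satisfies (generated_traces {1..K} {0} f) (parametric_formula a b \<psi>)"
      by (auto simp: realizable_def)
    define S where "S = {v. \<exists>k. 0 \<in> response K f v k}"
    have "\<not> P S v" if v: "v 3 2 = a" "v 3 3 = b" for v
    proof -
      let ?w = "\<lambda>i. response K f (v i)"
      have rep: "represents K (?w i) (v i)" for i using represents_response[OF f] .
      then have i: "interpretation_of K (assignment ?w) S v"
        unfolding interpretation_of_def by (simp add: S_def)
      \<comment> \<open>\<open>v i\<close> may be nonzero beyond \<open>K\<close>; its truncation is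
        presented by the same trace.\<close>
      have "\<exists>u. (\<forall>j\<ge>K. u j = 0) \<and> represents K (?w i) u" for i
        using rep[of i] by (intro exI[of _ "\<lambda>j. if j < K then v i j else 0"]) (auto simp: represents_def)
      then have wf: "ltl_sat (assignment ?w) 0 (well_formed K)"
        unfolding ltl_sat_well_formed by simp
      have "ltl_sat (assignment ?w) 0 (guarded a b \<psi>)"
        by (rule sat[unfolded satisfies_parametric_formula, rule_format]) (rule response_generated[OF f])
      then have "ltl_sat (assignment ?w) 0 \<psi>"
        using guard[where w = ?w and v = v and a = a and b = b, OF rep] v by blast
      then have "\<not> ltl_sat (assignment ?w) 0 \<chi>"
        unfolding \<psi>_def ltl_sat.simps using wf by blast
      then show ?thesis using \<chi>(3)[OF K(1) i] by blast
    qed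
    then show "\<exists>S. \<forall>v. v 3 2 = a \<and> v 3 3 = b \<longrightarrow> \<not> P S v" by blast
  next
    assume "\<exists>S. \<forall>v. v 3 2 = a \<and> v 3 3 = b \<longrightarrow> \<not> P S v"
    then obtain S where S: "\<And>v. v 3 2 = a \<Longrightarrow> v 3 3 = b \<Longrightarrow> \<not> P S v" by blast
    \<comment> \<open>A strategy sees only the history, so it marks as soon as all \<open>K\<close>
      entries of some zero-padded vector of \<open>S\<close> have been seen in it.\<close>
    define f :: "nat set list \<Rightarrow> nat set" where "f xs = (if \<exists>v\<in>S. (\<forall>j\<ge>K. v j = 0) \<and>
      (\<forall>j<K. v j < length xs \<and> Suc j \<in> xs ! v j) then {0} else {})" for xs
    have f: "f \<in> strategies {1..K} {0}" by (auto simp: strategies_def f_def)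
    have mark: "(\<exists>k. 0 \<in> w k) \<longleftrightarrow> v \<in> S"
      if w: "w \<in> generated_traces {1..K} {0} f" and rep: "represents K w v" and v: "\<forall>j\<ge>K. v j = 0" for w v
    proof -
      have "0 \<in> w k \<longleftrightarrow> 0 \<in> f (map (\<lambda>j. w j \<inter> {1..K}) [0..<Suc k])" for k
        using w unfolding generated_traces_def by blast
      also have "\<dots> k \<longleftrightarrow> (\<exists>u\<in>S. (\<forall>j\<ge>K. u j = 0) \<and> (\<forall>j<K. u j \<le> k \<and> Suc j \<in> w (u j)))" for k
      proof -
        let ?xs = "map (\<lambda>j. w j \<inter> {1..K}) [0..<Suc k]"
        have "?xs ! i = w i \<inter> {1..K}" if "i \<le> k" for i
          using that by (subst nth_map) (auto simp del: upt_Suc)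
        then have "(\<forall>j<K. u j < length ?xs \<and> Suc j \<in> ?xs ! u j) \<longleftrightarrow>
            (\<forall>j<K. u j \<le> k \<and> Suc j \<in> w (u j))" for u
          by (fastforce simp: less_Suc_eq_le simp del: upt_Suc)
        then show ?thesis unfolding f_def by (simp only:) simp
      qed
      also have "\<dots> k \<longleftrightarrow> v \<in> S \<and> (\<forall>j<K. v j \<le> k)" for k
      proof -
        \<comment> \<open>On a trace presenting \<open>v\<close>, proposition \<open>Suc j\<close>
          holds at \<open>v j\<close> only; with the zero padding this forces
          \<open>u = v\<close>.\<close>
        have "(\<forall>j\<ge>K. u j = 0) \<and> (\<forall>j<K. u j \<le> k \<and> Suc j \<in> w (u j)) \<longleftrightarrow>
            u = v \<and> (\<forall>j<K. v j \<le> k)" (is "?l u \<longleftrightarrow> _") for u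
        proof (intro iffI conjI)
          assume l: "?l u"
          show "u = v"
          proof
            fix j show "u j = v j" using l v rep by (cases "j < K") (auto simp: represents_def)
          qed
          with l show "\<forall>j<K. v j \<le> k" by blast
        qed (use v rep in \<open>auto simp: represents_def\<close>)
        then show ?thesis by (simp only:) blast
      qed
      finally have *: "0 \<in> w k \<longleftrightarrow> v \<in> S \<and> (\<forall>j<K. v j \<le> k)" for k .
      \<comment> \<open>By the position of the largest entry the whole vector has been read.\<close>
      have "\<forall>j<K. v j \<le> Max (v ` {..<K})" by auto
      then show ?thesis unfolding * by blast
    qed
    have "ltl_sat (assignment w) 0 (guarded a b \<psi>)"
      if w: "\<forall>i<4. w i \<in> generated_traces {1..K} {0} f" for w
    proof (cases "ltl_sat (assignment w) 0 (well_formed K)")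
      case True
      then have "\<forall>i<4. \<exists>v. (\<forall>j\<ge>K. v j = 0) \<and> represents K (w i) v"
        unfolding ltl_sat_well_formed by simp
      then obtain v where "\<forall>i<4. (\<forall>j\<ge>K. v i j = 0) \<and> represents K (w i) (v i)"
        by metis
      then have v: "\<And>i. i < 4 \<Longrightarrow> \<forall>j\<ge>K. v i j = 0" "\<And>i. i < 4 \<Longrightarrow> represents K (w i) (v i)"
        by blast+
      have "interpretation_of K (assignment w) S v"
        unfolding interpretation_of_def using v w mark by simp
      then have "ltl_sat (assignment w) 0 \<chi> \<longleftrightarrow> P S v" using \<chi>(3)[OF K(1)] by blast
      then show ?thesis
        using S[of v] guard[where w = w and v = v and a = a and b = b] v(2)[of 3] by (auto simp: \<psi>_def)
    next
      case False
      then show ?thesis by (simp add: guarded_def \<psi>_def)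
    qed
    then show "realizable {1..K} {0} (parametric_formula a b \<psi>)"
      unfolding realizable_def satisfies_parametric_formula using f by blast
  qed
  moreover have "atoms \<psi> \<subseteq> {..K}" "tvars \<psi> \<subseteq> {..<4}"
    using \<chi>(1,2) K atoms_well_formed[of K] tvars_well_formed[of K] by (auto simp: \<psi>_def)
  ultimately show ?thesis using that K by blast
qed

section \<open>Horn clauses for the evaluation of recursive functions\<close>

instance recfun :: countable by countable_datatype

text \<open>A kind fixes the functions and the arity and leaves only numbers to the vector.
  \<open>Positive_Below\<close> exists for \<open>Minimize\<close>: the universal premise of its
  rule is not Horn and has to be built up one argument at a time.\<close>

datatype fact = Value recfun nat | Values "recfun list" nat | Positive_Below recfun nat

instance fact :: countable by countable_datatype

definition slice :: "(nat \<Rightarrow> nat) \<Rightarrow> nat \<Rightarrow> nat \<Rightarrow> nat list" where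
  "slice v j n = map v [j..<j + n]"

lemma slice_0 [simp]: "slice v j 0 = []"
  by (simp add: slice_def)

lemma slice_Suc [simp]: "slice v j (Suc n) = v j # slice v (Suc j) n"
  by (simp add: slice_def upt_conv_Cons del: upt_Suc)

lemma length_slice [simp]: "length (slice v j n) = n"
  by (simp add: slice_def)

lemma nth_slice [simp]: "i < n \<Longrightarrow> slice v j n ! i = v (j + i)"
  by (simp add: slice_def)

lemma definable_slice_eq:
  "i < 4 \<Longrightarrow> i' < 4 \<Longrightarrow> definable (\<lambda>S v. slice (v i) j n = slice (v i') j' n)"
  by (induction n arbitrary: j j') (auto intro!: definable_and definable_eq definable_const)

text \<open>Entry 0 of a vector names the kind of fact, entry 1 holds the value, and the arguments start at
  entry 2. For lists of functions, the values follow the arguments.\<close>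

fun true_fact :: "fact \<Rightarrow> (nat \<Rightarrow> nat) \<Rightarrow> bool" where
  "true_fact (Value h n) v \<longleftrightarrow> rec_eval h (slice v 2 n) (v 1)"
| "true_fact (Values hs n) v \<longleftrightarrow>
     list_all2 (\<lambda>h y. rec_eval h (slice v 2 n) y) hs (slice v (2 + n) (length hs))"
| "true_fact (Positive_Below h n) v \<longleftrightarrow> (\<forall>m<v 2. \<exists>k. rec_eval h (m # slice v 3 n) (Suc k))"

definition true_facts :: "(nat \<Rightarrow> nat) set" where
  "true_facts = {v. \<exists>q. v 0 = to_nat q \<and> true_fact q v}"

lemma true_facts_iff: "v 0 = to_nat q \<Longrightarrow> v \<in> true_facts \<longleftrightarrow> true_fact q v"
  by (auto simp: true_facts_def)

section \<open>The Horn clauses\<close>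

type_synonym clause = "(nat \<Rightarrow> nat) set \<Rightarrow> (nat \<Rightarrow> nat \<Rightarrow> nat) \<Rightarrow> bool"

abbreviation of_kind :: "(nat \<Rightarrow> nat) \<Rightarrow> fact \<Rightarrow> bool" where
  "of_kind v q \<equiv> v 0 = to_nat q"

text \<open>In a clause, \<open>v 0\<close> and \<open>v 1\<close> are the premises and \<open>v 2\<close> is the conclusion.\<close>

primrec list_clauses :: "recfun list \<Rightarrow> nat \<Rightarrow> clause" where
  "list_clauses [] n = (\<lambda>S v. of_kind (v 2) (Values [] n))"
| "list_clauses (h # hs) n = (\<lambda>S v. list_clauses hs n S v \<or>
     (v 0 \<in> S \<and> v 1 \<in> S \<and> of_kind (v 0) (Value h n) \<and> of_kind (v 1) (Values hs n) \<and>
      of_kind (v 2) (Values (h # hs) n) \<and>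
      slice (v 0) 2 n = slice (v 2) 2 n \<and> slice (v 1) 2 n = slice (v 2) 2 n \<and>
      v 2 (2 + n) = v 0 1 \<and>
      slice (v 1) (2 + n) (length hs) = slice (v 2) (3 + n) (length hs)))"

text \<open>The rules of \<open>rec_eval\<close> for all subterms, each at the arity at which it is
  called; this keeps the disjunction finite. The arity is explicit because terms carry none, and
  \<open>n \<noteq> 0\<close> reflects that \<open>PrimRec\<close> has no value on the empty
  list.\<close>

fun clauses :: "recfun \<Rightarrow> nat \<Rightarrow> clause" where
  "clauses Zero n = (\<lambda>S v. of_kind (v 2) (Value Zero n) \<and> v 2 1 = 0)"
| "clauses Succ n = (\<lambda>S v. n = 1 \<and> of_kind (v 2) (Value Succ n) \<and> v 2 1 = Suc (v 2 2))"
| "clauses (Proj i) n = (\<lambda>S v. i < n \<and> of_kind (v 2) (Value (Proj i) n) \<and> v 2 1 = v 2 (2 + i))"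
| "clauses (Comp f gs) n = (\<lambda>S v. clauses f (length gs) S v \<or> (\<exists>g\<in>set gs. clauses g n S v) \<or>
     list_clauses gs n S v \<or>
     (v 0 \<in> S \<and> v 1 \<in> S \<and> of_kind (v 0) (Value f (length gs)) \<and> of_kind (v 1) (Values gs n) \<and>
      of_kind (v 2) (Value (Comp f gs) n) \<and> v 2 1 = v 0 1 \<and>
      slice (v 2) 2 n = slice (v 1) 2 n \<and>
      slice (v 0) 2 (length gs) = slice (v 1) (2 + n) (length gs)))"
| "clauses (PrimRec f g) n = (\<lambda>S v. n \<noteq> 0 \<and> (clauses f (n - 1) S v \<or> clauses g (Suc n) S v \<or>
     (v 0 \<in> S \<and> of_kind (v 0) (Value f (n - 1)) \<and> of_kind (v 2) (Value (PrimRec f g) n) \<and>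
      v 2 1 = v 0 1 \<and> v 2 2 = 0 \<and> slice (v 2) 3 (n - 1) = slice (v 0) 2 (n - 1)) \<or>
     (v 0 \<in> S \<and> v 1 \<in> S \<and> of_kind (v 0) (Value (PrimRec f g) n) \<and> of_kind (v 1) (Value g (Suc n)) \<and>
      of_kind (v 2) (Value (PrimRec f g) n) \<and> v 2 1 = v 1 1 \<and> v 2 2 = Suc (v 0 2) \<and>
      v 1 2 = v 0 2 \<and> v 1 3 = v 0 1 \<and>
      slice (v 2) 3 (n - 1) = slice (v 0) 3 (n - 1) \<and>
      slice (v 1) 4 (n - 1) = slice (v 0) 3 (n - 1))))"
| "clauses (Minimize f) n = (\<lambda>S v. clauses f (Suc n) S v \<or>
     (of_kind (v 2) (Positive_Below f n) \<and> v 2 2 = 0) \<or>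
     (v 0 \<in> S \<and> v 1 \<in> S \<and> of_kind (v 0) (Value f (Suc n)) \<and> of_kind (v 1) (Positive_Below f n) \<and>
      of_kind (v 2) (Positive_Below f n) \<and> v 0 1 \<noteq> 0 \<and> v 0 2 = v 1 2 \<and> v 2 2 = Suc (v 1 2) \<and>
      slice (v 0) 3 n = slice (v 1) 3 n \<and> slice (v 2) 3 n = slice (v 1) 3 n) \<or>
     (v 0 \<in> S \<and> v 1 \<in> S \<and> of_kind (v 0) (Value f (Suc n)) \<and> of_kind (v 1) (Positive_Below f n) \<and>
      of_kind (v 2) (Value (Minimize f) n) \<and> v 0 1 = 0 \<and> v 0 2 = v 1 2 \<and> v 2 1 = v 1 2 \<and>
      slice (v 0) 3 n = slice (v 1) 3 n \<and> slice (v 2) 2 n = slice (v 1) 3 n))"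

lemmas definable_intros = definable_mem definable_eq_const definable_eq definable_eq_Suc
  definable_not definable_or definable_and definable_const definable_Bex definable_slice_eq

lemma definable_list_clauses: "definable (list_clauses hs n)"
  by (induction hs) (auto intro!: definable_intros)

lemma definable_clauses: "definable (clauses h n)"
  by (induction h n rule: clauses.induct)
    (auto simp del: neq0_conv intro!: definable_intros definable_list_clauses)

section \<open>Soundness: the true facts are closed under the clauses\<close>

lemma list_clauses_sound: "list_clauses hs n true_facts v \<Longrightarrow> v 2 \<in> true_facts"
  by (induction hs) (auto simp: true_facts_iff numeral_eq_Suc)

text \<open>Each clause mirrors an introduction rule of \<open>rec_eval\<close> or extends a chain
  of \<open>Values\<close> or \<open>Positive_Below\<close> facts by one link.\<close>

lemma clauses_sound: "clauses h n true_facts v \<Longrightarrow> v 2 \<in> true_facts"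
proof (induction h n rule: clauses.induct)
  case (1 n)
  then show ?case by (auto simp: true_facts_iff intro: rec_eval.intros)
next
  case (2 n)
  then show ?case by (auto simp: true_facts_iff numeral_eq_Suc intro: rec_eval.intros)
next
  case (3 i n)
  then show ?case using rec_eval.Proj[of i "slice (v 2) 2 n"] by (auto simp: true_facts_iff)
next
  case (4 f gs n)
  then show ?case using list_clauses_sound[of gs n v]
    by (auto simp: true_facts_iff intro: rec_eval.Comp)
next
  case (5 f g n)
  then obtain k where "n = Suc k" by (cases n) auto
  with 5 show ?case
    by (auto simp: true_facts_iff numeral_eq_Suc intro: rec_eval.PrimRec_0 rec_eval.PrimRec_Suc)
next
  case (6 f n)
  then show ?case
    by (auto simp: true_facts_iff numeral_eq_Suc less_Suc_eq gr0_conv_Suc intro!: rec_eval.Minimize)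
qed


section \<open>Completeness: every closed set contains the true values\<close>

definition fact_vector :: "fact \<Rightarrow> nat list \<Rightarrow> nat \<Rightarrow> nat" where
  "fact_vector q xs j = (if j = 0 then to_nat q else xs ! (j - 1))"

lemma fact_vector_0 [simp]: "fact_vector q xs 0 = to_nat q"
  by (simp add: fact_vector_def)

lemma fact_vector_pos [simp]: "j > 0 \<Longrightarrow> fact_vector q xs j = xs ! (j - 1)"
  by (simp add: fact_vector_def)

lemma slice_fact_vector [simp]:
  "j > 0 \<Longrightarrow> j - 1 + n \<le> length xs \<Longrightarrow> slice (fact_vector q xs) j n = take n (drop (j - 1) xs)"
  by (rule nth_equalityI) auto

definition closed_under :: "clause \<Rightarrow> (nat \<Rightarrow> nat) set \<Rightarrow> bool" where
  "closed_under C S \<longleftrightarrow> (\<forall>v. C S v \<longrightarrow> v 2 \<in> S)"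

text \<open>Packages one application of a clause: premises at 0 and 1, the conclusion everywhere
  else and thus at 2.\<close>

lemma closed_underD:
  assumes "closed_under C S" "C S ((\<lambda>_. u)(0 := u\<^sub>0, 1 := u\<^sub>1))"
  shows "u \<in> S"
  using assms unfolding closed_under_def by fastforce

lemma closed_under_mono: "closed_under C S \<Longrightarrow> (\<And>v. D S v \<Longrightarrow> C S v) \<Longrightarrow> closed_under D S"
  unfolding closed_under_def by blast

lemma list_clauses_complete:
  assumes "closed_under (list_clauses hs n) S"
    and "\<forall>h\<in>set hs. \<forall>u. of_kind u (Value h n) \<longrightarrow> true_fact (Value h n) u \<longrightarrow> u \<in> S"
    and "of_kind u (Values hs n)" "true_fact (Values hs n) u"
  shows "u \<in> S"
  using assms
proof (induction hs arbitrary: u)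
  case Nil
  show ?case by (rule closed_underD[OF Nil(1), of _ u u]) (use Nil(3) in simp)
next
  case (Cons h hs)
  let ?v0 = "fact_vector (Value h n) (u (2 + n) # slice u 2 n)"
  \<comment> \<open>The 0 fills entry 1, which holds a value only for \<open>Value\<close>
    facts.\<close>
  let ?v1 = "fact_vector (Values hs n) (0 # slice u 2 n @ slice u (3 + n) (length hs))"
  have t: "rec_eval h (slice u 2 n) (u (2 + n))"
    "list_all2 (\<lambda>h y. rec_eval h (slice u 2 n) y) hs (slice u (3 + n) (length hs))"
    using Cons.prems(4) by (simp_all add: numeral_eq_Suc)
  have "of_kind ?v0 (Value h n)" "true_fact (Value h n) ?v0"
    using t by simp_all
  then have "?v0 \<in> S" using Cons.prems(2) by simp
  moreover have "?v1 \<in> S"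
  proof (rule Cons.IH)
    show "closed_under (list_clauses hs n) S"
      by (rule closed_under_mono[OF Cons.prems(1)]) simp
  qed (use Cons.prems(2) t in simp_all)
  ultimately show ?case
    using Cons.prems(3) by (intro closed_underD[OF Cons.prems(1), of _ ?v0 ?v1]) simp
qed

text \<open>Induction along the recursion of \<open>clauses\<close>: closure under the clauses of a
  term includes closure under those of its subterms, so the premises of the last evaluation rule are
  in \<open>S\<close>, and its clause adds the conclusion.\<close>

lemma clauses_complete:
  assumes "closed_under (clauses h n) S"
    and "of_kind u (Value h n)" "true_fact (Value h n) u"
  shows "u \<in> S"
  using assms
proof (induction h n arbitrary: u rule: clauses.induct)
  case (1 n)
  then have "u 1 = 0" by (auto elim: rec_evalE)
  then show ?case using "1.prems"(2) by (intro closed_underD[OF "1.prems"(1), of _ u u]) simp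
next
  case (2 n)
  then have "rec_eval Succ (slice u 2 n) (u 1)" by simp
  then have *: "\<exists>x. slice u 2 n = [x] \<and> u 1 = Suc x" by (elim rec_evalE) auto
  then have "n = 1" by (metis One_nat_def length_Cons length_slice list.size(3))
  then show ?case using * "2.prems"(2) by (intro closed_underD[OF "2.prems"(1), of _ u u]) simp
next
  case (3 i n)
  then have "rec_eval (Proj i) (slice u 2 n) (u 1)" by simp
  then have "i < n \<and> u 1 = u (2 + i)" by (elim rec_evalE) auto
  then show ?case using "3.prems"(2) by (intro closed_underD[OF "3.prems"(1), of _ u u]) simp
next
  case (4 f gs n)
  then have "rec_eval (Comp f gs) (slice u 2 n) (u 1)" by simp
  then obtain ys where ys: "list_all2 (\<lambda>g y. rec_eval g (slice u 2 n) y) gs ys" "rec_eval f ys (u 1)"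
    by (elim rec_evalE)
  then have len: "length ys = length gs" by (simp add: list_all2_lengthD)
  let ?v0 = "fact_vector (Value f (length gs)) (u 1 # ys)"
  let ?v1 = "fact_vector (Values gs n) (0 # slice u 2 n @ ys)"
  have "?v0 \<in> S"
  proof (rule "4.IH"(1))
    show "closed_under (clauses f (length gs)) S"
      by (rule closed_under_mono[OF "4.prems"(1)]) simp
  qed (use ys len in simp_all)
  moreover have "?v1 \<in> S"
  proof (rule list_clauses_complete)
    show "closed_under (list_clauses gs n) S"
      by (rule closed_under_mono[OF "4.prems"(1)]) simp
    show "\<forall>g\<in>set gs. \<forall>u. of_kind u (Value g n) \<longrightarrow> true_fact (Value g n) u \<longrightarrow> u \<in> S"
    proof (intro ballI allI impI)
      fix g u assume g: "g \<in> set gs" and u: "of_kind u (Value g n)" "true_fact (Value g n) u"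
      have "closed_under (clauses g n) S"
        by (rule closed_under_mono[OF "4.prems"(1)]) (use g in auto)
      then show "u \<in> S" using "4.IH"(2)[OF g] u by blast
    qed
  qed (use ys len in simp_all)
  ultimately show ?case
    using "4.prems"(2) len by (intro closed_underD[OF "4.prems"(1), of _ ?v0 ?v1]) simp
next
  case (5 f g n)
  then have r: "rec_eval (PrimRec f g) (slice u 2 n) (u 1)" by simp
  have "n \<noteq> 0"
  proof
    assume "n = 0"
    with r have "rec_eval (PrimRec f g) [] (u 1)" by simp
    then show False by cases
  qed
  then obtain k where n: "n = Suc k" by (cases n) auto
  have cl: "closed_under (clauses f k) S" "closed_under (clauses g (Suc n)) S"
    by (rule closed_under_mono[OF "5.prems"(1)]; simp add: n)+
  \<comment> \<open>Inner induction on the recursion argument. \<open>u\<close> is generalized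
    because the value changes from step to step.\<close>
  have *: "u \<in> S" if "rec_eval (PrimRec f g) (m # slice u 3 k) (u 1)"
    "of_kind u (Value (PrimRec f g) n)" "u 2 = m" for m u
    using that
  proof (induction m arbitrary: u)
    case 0
    then have y: "rec_eval f (slice u 3 k) (u 1)" by (elim rec_evalE)
    let ?v0 = "fact_vector (Value f k) (u 1 # slice u 3 k)"
    have "?v0 \<in> S"
      by (rule "5.IH"(1)) (use cl y n in simp_all)
    then show ?case
      using n 0 by (intro closed_underD[OF "5.prems"(1), of _ ?v0 ?v0]) simp
  next
    case (Suc m)
    then obtain z where z: "rec_eval (PrimRec f g) (m # slice u 3 k) z"
        "rec_eval g (m # z # slice u 3 k) (u 1)"
      by (elim rec_evalE)
    let ?v0 = "fact_vector (Value (PrimRec f g) n) (z # m # slice u 3 k)"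
    let ?v1 = "fact_vector (Value g (Suc n)) (u 1 # m # z # slice u 3 k)"
    have "?v0 \<in> S"
      by (rule Suc.IH) (use z in simp_all)
    moreover have "?v1 \<in> S"
      by (rule "5.IH"(2)) (use cl z n in simp_all)
    ultimately show ?case
      using n Suc.prems by (intro closed_underD[OF "5.prems"(1), of _ ?v0 ?v1]) simp
  qed
  show ?case by (rule *) (use r n "5.prems"(2) in \<open>simp_all add: numeral_eq_Suc\<close>)
next
  case (6 f n)
  then have "rec_eval (Minimize f) (slice u 2 n) (u 1)" by simp
  then have zero: "rec_eval f (u 1 # slice u 2 n) 0"
    and pos: "\<forall>m<u 1. \<exists>k. rec_eval f (m # slice u 2 n) (Suc k)"
    by (elim rec_evalE; simp)+
  have val: "fact_vector (Value f (Suc n)) (y # m # slice u 2 n) \<in> S"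
    if "rec_eval f (m # slice u 2 n) y" for y m
  proof (rule "6.IH")
    show "closed_under (clauses f (Suc n)) S"
      by (rule closed_under_mono[OF "6.prems"(1)]) simp
  qed (use that in simp_all)
  \<comment> \<open>Climb from bound 0 to the least zero \<open>u 1\<close>; each step uses the
    positive value of \<open>f\<close> at \<open>m\<close>.\<close>
  have below: "fact_vector (Positive_Below f n) (0 # m # slice u 2 n) \<in> S" (is "?u m \<in> S")
    if "m \<le> u 1" for m
    using that
  proof (induction m)
    case 0
    show ?case by (rule closed_underD[OF "6.prems"(1), of _ "?u 0" "?u 0"]) simp
  next
    case (Suc m)
    then obtain k where k: "rec_eval f (m # slice u 2 n) (Suc k)" using Suc_le_eq pos by blast
    let ?v0 = "fact_vector (Value f (Suc n)) (Suc k # m # slice u 2 n)"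
    have "?v0 \<in> S" "?u m \<in> S" using val[OF k] Suc by simp_all
    then show ?case by (intro closed_underD[OF "6.prems"(1), of _ ?v0 "?u m"]) simp
  qed
  let ?v0 = "fact_vector (Value f (Suc n)) (0 # u 1 # slice u 2 n)"
  have "?v0 \<in> S" "?u (u 1) \<in> S" using val[OF zero] below by simp_all
  then show ?case
    using "6.prems"(2) by (intro closed_underD[OF "6.prems"(1), of _ ?v0 "?u (u 1)"]) simp
qed

lemma list_clauses_cong:
  assumes "v' 0 = v 0" "v' 1 = v 1" "v' 2 = v 2"
  shows "list_clauses hs n S v' \<longleftrightarrow> list_clauses hs n S v"
  using assms by (induction hs) simp_all

text \<open>Clauses read only variables 0 to 2, so variable 3 is free to carry the
  parameters.\<close>

lemma clauses_cong:
  assumes "v' 0 = v 0" "v' 1 = v 1" "v' 2 = v 2"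
  shows "clauses h n S v' \<longleftrightarrow> clauses h n S v"
  using assms list_clauses_cong[OF assms]
  by (induction h n rule: clauses.induct) simp_all

text \<open>If \<open>h\<close> does not evaluate to 1 on \<open>[a, b]\<close>, the true facts are
  an admissible set; otherwise every set closed under the clauses contains the forbidden fact. The
  guard reads entries 2 and 3 of variable 3, exactly the argument entries of a
  \<open>Value h 2\<close> fact.\<close>

lemma realizable_iff_not_rec_eval:
  obtains K \<psi> where "K \<ge> 4" "atoms \<psi> \<subseteq> {..K}" "tvars \<psi> \<subseteq> {..<4}"
    "\<And>a b. realizable {1..K} {0} (parametric_formula a b \<psi>) \<longleftrightarrow> \<not> rec_eval h [a, b] 1"
proof -
  define P :: clause where "P S v \<longleftrightarrow> (clauses h 2 S v \<and> v 2 \<notin> S) \<or>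
    (v 3 \<in> S \<and> of_kind (v 3) (Value h 2) \<and> v 3 1 = 1)" for S v
  have "definable P"
    unfolding P_def by (auto intro!: definable_intros definable_clauses)
  moreover have "(\<exists>S. \<forall>v. v 3 2 = a \<and> v 3 3 = b \<longrightarrow> \<not> P S v) \<longleftrightarrow> \<not> rec_eval h [a, b] 1" for a b
  proof
    assume "\<exists>S. \<forall>v. v 3 2 = a \<and> v 3 3 = b \<longrightarrow> \<not> P S v"
    then obtain S where S: "\<And>v. v 3 2 = a \<Longrightarrow> v 3 3 = b \<Longrightarrow> \<not> P S v" by blast
    \<comment> \<open>The forbidden fact itself; it also satisfies the guard.\<close>
    let ?u = "fact_vector (Value h 2) [1, a, b]"
    have u: "?u 2 = a" "?u 3 = b" "?u 1 = 1" "slice ?u 2 2 = [a, b]" by simp_all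
    have "closed_under (clauses h 2) S"
      unfolding closed_under_def
    proof (intro allI impI)
      fix v assume "clauses h 2 S v"
      \<comment> \<open>Putting \<open>?u\<close> into variable 3 meets the guard without affecting
        the clause.\<close>
      then have "clauses h 2 S (v(3 := ?u))" by (subst clauses_cong[of _ v]) simp_all
      moreover have "\<not> P S (v(3 := ?u))" by (rule S) (use u in simp_all)
      ultimately show "v 2 \<in> S" by (simp add: P_def)
    qed
    moreover have "?u \<notin> S" using S[of "\<lambda>_. ?u"] u unfolding P_def by auto
    ultimately show "\<not> rec_eval h [a, b] 1"
      using clauses_complete[of h 2 S ?u] u by auto
  next
    assume r: "\<not> rec_eval h [a, b] 1"
    have "\<not> P true_facts v" if "v 3 2 = a" "v 3 3 = b" for v
    proof -
      have "slice (v 3) 2 2 = [a, b]" using that by (simp add: numeral_eq_Suc)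
      then show ?thesis using clauses_sound[of h 2 v] r unfolding P_def by (auto simp: true_facts_iff)
    qed
    then show "\<exists>S. \<forall>v. v 3 2 = a \<and> v 3 3 = b \<longrightarrow> \<not> P S v" by blast
  qed
  ultimately show ?thesis using that realizable_parametric_formula[of P] by metis
qed

section \<open>Computing the code of the formula\<close>

definition computable :: "nat \<Rightarrow> (nat list \<Rightarrow> nat) \<Rightarrow> bool" where
  "computable n F \<longleftrightarrow> (\<exists>r. \<forall>xs. length xs = n \<longrightarrow> rec_eval r xs (F xs))"

lemma computable_nth: "i < n \<Longrightarrow> computable n (\<lambda>xs. xs ! i)"
  unfolding computable_def by (auto intro!: exI[of _ "Proj i"] rec_eval.Proj)

lemma computable_comp1:
  assumes "computable (Suc 0) (\<lambda>xs. F (xs ! 0))" "computable n G"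
  shows "computable n (\<lambda>xs. F (G xs))"
proof -
  from assms(1) obtain f where "\<And>xs. length xs = Suc 0 \<Longrightarrow> rec_eval f xs (F (xs ! 0))"
    unfolding computable_def by blast
  from this[of "[_]"] have "\<And>x. rec_eval f [x] (F x)" by simp
  moreover from assms(2) obtain g where "\<And>xs. length xs = n \<Longrightarrow> rec_eval g xs (G xs)"
    unfolding computable_def by blast
  ultimately show ?thesis
    unfolding computable_def by (intro exI[of _ "Comp f [g]"]) (auto intro!: rec_eval.Comp[of _ _ "[_]"])
qed

lemma computable_comp2:
  assumes "computable 2 (\<lambda>xs. F (xs ! 0) (xs ! 1))" "computable n G" "computable n H"
  shows "computable n (\<lambda>xs. F (G xs) (H xs))"
proof -
  from assms(1) obtain f where "\<And>xs. length xs = 2 \<Longrightarrow> rec_eval f xs (F (xs ! 0) (xs ! 1))"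
    unfolding computable_def by blast
  from this[of "[_, _]"] have "\<And>x y. rec_eval f [x, y] (F x y)" by simp
  moreover from assms obtain g h where "\<And>xs. length xs = n \<Longrightarrow> rec_eval g xs (G xs)"
    "\<And>xs. length xs = n \<Longrightarrow> rec_eval h xs (H xs)"
    unfolding computable_def by blast
  ultimately show ?thesis
    unfolding computable_def
    by (intro exI[of _ "Comp f [g, h]"]) (auto intro!: rec_eval.Comp[of _ _ "[_, _]"])
qed

lemma computable_Suc: "computable n F \<Longrightarrow> computable n (\<lambda>xs. Suc (F xs))"
proof (rule computable_comp1[where F = Suc])
  show "computable (Suc 0) (\<lambda>xs. Suc (xs ! 0))"
    unfolding computable_def by (auto simp: length_Suc_conv intro!: exI[of _ Succ] rec_eval.Succ)
qed

lemma computable_const: "computable n (\<lambda>xs. c)"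
proof (induction c)
  case 0
  show ?case unfolding computable_def by (auto intro!: exI[of _ Zero] rec_eval.Zero)
qed (rule computable_Suc)

lemma computable_rec:
  assumes "computable 2 (\<lambda>xs. F (xs ! 0) (xs ! 1))" "computable n G" "computable n H"
  shows "computable n (\<lambda>xs. rec_nat (G xs) F (H xs))"
proof (rule computable_comp2[where F = "\<lambda>m y. rec_nat y F m"])
  from assms(1) obtain f where "\<And>xs. length xs = 2 \<Longrightarrow> rec_eval f xs (F (xs ! 0) (xs ! 1))"
    unfolding computable_def by blast
  from this[of "[_, _]"] have f: "rec_eval f [x, y] (F x y)" for x y by simp
  have p: "rec_eval (Proj 0) (x # xs) x" "rec_eval (Proj (Suc 0)) (x # y # xs) y" for x y xs
    using rec_eval.Proj[of 0 "x # xs"] rec_eval.Proj[of "Suc 0" "x # y # xs"] by simp_all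
  \<comment> \<open>The second argument \<open>y\<close> is the initial value; the projections hide
    it from the step function.\<close>
  have "rec_eval (PrimRec (Proj 0) (Comp f [Proj 0, Proj 1])) [m, y] (rec_nat y F m)" for m y
  proof (induction m)
    case 0
    show ?case by (auto intro: rec_eval.PrimRec_0 p)
  next
    case (Suc m)
    have "rec_eval (Comp f [Proj 0, Proj 1]) [m, rec_nat y F m, y] (F m (rec_nat y F m))"
      by (rule rec_eval.Comp[of _ _ "[_, _]"]) (auto intro: p f)
    with Suc show ?case by (auto intro: rec_eval.PrimRec_Suc)
  qed
  then show "computable 2 (\<lambda>xs. rec_nat (xs ! 1) F (xs ! 0))"
    unfolding computable_def
    by (intro exI[of _ "PrimRec (Proj 0) (Comp f [Proj 0, Proj 1])"])
      (auto simp: numeral_2_eq_2 length_Suc_conv)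
qed (use assms in auto)

lemma computable_add:
  assumes "computable n F" "computable n G"
  shows "computable n (\<lambda>xs. F xs + G xs)"
proof -
  have "rec_nat y (\<lambda>_. Suc) x = x + y" for x y by (induction x) auto
  moreover have "computable 2 (\<lambda>xs. Suc (xs ! 1))"
    by (intro computable_Suc computable_nth) auto
  ultimately show ?thesis
    using computable_rec[where F = "\<lambda>_. Suc", OF _ assms(2,1)] by simp
qed

lemma computable_triangle:
  assumes "computable n F" shows "computable n (\<lambda>xs. triangle (F xs))"
proof -
  have "rec_nat 0 (\<lambda>m r. r + Suc m) x = triangle x" for x by (induction x) auto
  moreover have "computable 2 (\<lambda>xs. xs ! 1 + Suc (xs ! 0))"
    by (intro computable_add computable_Suc computable_nth) auto
  ultimately show ?thesis
    using computable_rec[where F = "\<lambda>m r. r + Suc m", OF _ computable_const[of n 0] assms] by simp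
qed

lemma computable_prod_encode:
  assumes "computable n F" "computable n G"
  shows "computable n (\<lambda>xs. prod_encode (F xs, G xs))"
  using assms by (auto simp: prod_encode_def intro!: computable_add computable_triangle)

text \<open>Every \<open>Next\<close> wraps the code with tag 3, so the code of a chain is an
  iteration of its length.\<close>

lemma computable_ltl_code_nexts:
  assumes "computable n F"
  shows "computable n (\<lambda>xs. ltl_code (nexts (F xs) \<psi>))"
proof -
  have "rec_nat (ltl_code \<psi>) (\<lambda>_ r. prod_encode (3, r)) m = ltl_code (nexts m \<psi>)" for m
    by (induction m) auto
  moreover have "computable 2 (\<lambda>xs. prod_encode (3, xs ! 1))"
    by (intro computable_prod_encode computable_const computable_nth) auto
  ultimately show ?thesis
    using computable_rec[where F = "\<lambda>_ r. prod_encode (3, r)",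
        OF _ computable_const[of n "ltl_code \<psi>"] assms]
    by simp
qed

text \<open>Both numbers have two roles: they are the codes of the input set and of the body, and
  they are the lengths of the \<open>Next\<close> chains in the guard.\<close>

lemma instance_code_computable:
  obtains r where "\<And>Inp \<psi>. rec_eval r [set_encode Inp, ltl_code \<psi>]
    (instance_code (Inp, {0}, parametric_formula (set_encode Inp) (ltl_code \<psi>) \<psi>))"
proof -
  \<comment> \<open>The constants are the constructor tags and the names of the four quantified
    variables; \<open>b\<close> stands in the place of the code of the body.\<close>
  define F where "F a b =
    prod_encode (a, prod_encode (set_encode {0}, prod_encode (1, prod_encode (0,
      prod_encode (1, prod_encode (1, prod_encode (1, prod_encode (2, prod_encode (1, prod_encode (3,
      prod_encode (2,
        prod_encode (2, prod_encode (prod_encode (1, ltl_code (nexts a (Atom 3 3))),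
        prod_encode (2, prod_encode (prod_encode (1, ltl_code (nexts b (Atom 4 3))), b)))))))))))))))" for a b
  have "computable 2 (\<lambda>xs. F (xs ! 0) (xs ! 1))"
    unfolding F_def
    by (intro computable_prod_encode computable_ltl_code_nexts computable_const computable_nth) auto
  then obtain r where r: "\<And>xs. length xs = 2 \<Longrightarrow> rec_eval r xs (F (xs ! 0) (xs ! 1))"
    unfolding computable_def by blast
  have "instance_code (Inp, {0}, parametric_formula (set_encode Inp) (ltl_code \<psi>) \<psi>) =
      F (set_encode Inp) (ltl_code \<psi>)" for Inp \<psi>
    by (simp add: instance_code_def parametric_formula_def guarded_def F_def)
  then have "rec_eval r [set_encode Inp, ltl_code \<psi>]
    (instance_code (Inp, {0}, parametric_formula (set_encode Inp) (ltl_code \<psi>) \<psi>))" for Inp \<psi>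
    using r[of "[set_encode Inp, ltl_code \<psi>]"] by simp
  then show ?thesis using that by blast
qed

text \<open>A purely universal formula is an instance with an empty existential block.\<close>

lemma parametric_formula_instance:
  assumes "K \<ge> 4" "atoms \<psi> \<subseteq> {..K}" "tvars \<psi> \<subseteq> {..<4}"
  shows "({1..K}, {0}, parametric_formula a b \<psi>) \<in> forall_exists_instances"
proof -
  have "parametric_formula a b \<psi> = foldr Forall [0, 1, 2, 3] (foldr Exists [] (QF (guarded a b \<psi>)))"
    by (simp add: parametric_formula_def)
  moreover have "{..K} = {1..K} \<union> {0}" by auto
  then have "atoms (guarded a b \<psi>) \<subseteq> {1..K} \<union> {0}"
    using assms(1,2) by (auto simp: guarded_def)
  moreover have "{..<4} = set [0, 1, 2, 3 :: nat]" by auto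
  then have "tvars (guarded a b \<psi>) \<subseteq> set [0, 1, 2, 3] \<union> set []"
    using assms(3) by (auto simp: guarded_def)
  ultimately show ?thesis
    unfolding forall_exists_instances_def
    by (intro CollectI exI[of _ "{1..K}"] exI[of _ "{0}"] exI[of _ "[0, 1, 2, 3]"] exI[of _ "[]"]
        exI[of _ "guarded a b \<psi>"] conjI) (simp_all only: finite.intros finite_atLeastAtMost, simp)
qed

section \<open>Diagonalisation\<close>

theorem mainTheorem8:
  "\<not> decidable instance_code forall_exists_instances (\<lambda>(Inp, Out, \<phi>). realizable Inp Out \<phi>)"
proof
  assume "decidable instance_code forall_exists_instances (\<lambda>(Inp, Out, \<phi>). realizable Inp Out \<phi>)"
  then obtain d where d: "(Inp, Out, \<phi>) \<in> forall_exists_instances \<Longrightarrow>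
      rec_eval d [instance_code (Inp, Out, \<phi>)] (if realizable Inp Out \<phi> then 1 else 0)" for Inp Out \<phi>
    unfolding decidable_def by fastforce
  obtain r where r: "\<And>Inp \<psi>. rec_eval r [set_encode Inp, ltl_code \<psi>]
    (instance_code (Inp, {0}, parametric_formula (set_encode Inp) (ltl_code \<psi>) \<psi>))"
    using instance_code_computable by blast
  \<comment> \<open>\<open>r\<close> assembles the code of the instance, \<open>d\<close> decides
    it.\<close>
  define g where "g = Comp d [r]"
  obtain K \<psi> where \<psi>: "K \<ge> 4" "atoms \<psi> \<subseteq> {..K}" "tvars \<psi> \<subseteq> {..<4}" and
    iff: "\<And>a b. realizable {1..K} {0} (parametric_formula a b \<psi>) \<longleftrightarrow> \<not> rec_eval g [a, b] 1"
    using realizable_iff_not_rec_eval[of g] by blast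
  \<comment> \<open>\<open>K\<close> and \<open>\<psi>\<close> are already fixed, so their own codes
    may serve as parameters; the formula about \<open>g\<close> on \<open>[?a, ?b]\<close> is then
    the one whose code \<open>r\<close> computes.\<close>
  let ?a = "set_encode {1..K}" and ?b = "ltl_code \<psi>"
  let ?real = "realizable {1..K} {0} (parametric_formula ?a ?b \<psi>)"
  have "rec_eval d [instance_code ({1..K}, {0}, parametric_formula ?a ?b \<psi>)] (if ?real then 1 else 0)"
    using d parametric_formula_instance[OF \<psi>] by blast
  then have eval: "rec_eval g [?a, ?b] (if ?real then 1 else 0)"
    unfolding g_def using r by (intro rec_eval.Comp[of _ _ "[_]"]) auto
  show False
  proof (cases ?real)
    case True
    then show False using eval iff by simp
  next
    case False
    \<comment> \<open>Unrealizability says that \<open>g\<close> yields 1, while \<open>d\<close>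
      answers 0; evaluation is deterministic.\<close>
    then have "rec_eval g [?a, ?b] 1" using iff by blast
    moreover have "rec_eval g [?a, ?b] 0" using eval False by simp
    ultimately show False using rec_eval_deterministic by fastforce
  qed
qed

end
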